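(* For every unsatisfiable hitting clause-set $F$, $\mathrm{nsv}(F)\ge \frac12\,\mathrm{singind}(F)$.
   Context: Variables are positive integers, literals are nonzero integers, the complement of $x$ is $\overline{x}=-x$. A clause is a finite set of literals with no pair $x,\overline{x}$; a clause-set is a finite set of clauses. $F$ is satisfiable if some clause meets every clause of $F$, otherwise unsatisfiable. $F$ is hitting if any two distinct clauses $C,D\in F$ have some $x\in C$ with $\overline{x}\in D$. $\mathrm{ldeg}_F(x)$ is the number of clauses containing $x$; a variable $v$ of $F$ is singular if $\min(\mathrm{ldeg}_F(v),\mathrm{ldeg}_F(\overline v))=1$; $\mathrm{nsv}(F)$ is the number of singular variables of $F$. For a singular variable $v$, singular DP-reduction replaces $F$ by $\mathrm{DP}_v(F):=\{(A\cup B)\setminus\{v,\overline v\}: A,B\in F, A\cap\overline{B}=\{v\}\}\cup\{A\in F: v \text{ does not occur in } A\}$. For an unsatisfiable hitting clause-set $F$, every maximal sequence of singular DP-reductions (ending when no singular variable remains) has the same length, denoted $\mathrm{singind}(F)$. *)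

theory Defs
  imports Complex_Main
begin

definition clause :: "int set \<Rightarrow> bool" where
  "clause C \<longleftrightarrow> finite C \<and> 0 \<notin> C \<and> (\<forall>x\<in>C. - x \<notin> C)"

definition clause_set :: "int set set \<Rightarrow> bool" where
  "clause_set F \<longleftrightarrow> finite F \<and> (\<forall>C\<in>F. clause C)"

definition satisfiable :: "int set set \<Rightarrow> bool" where
  "satisfiable F \<longleftrightarrow> (\<exists>C. clause C \<and> (\<forall>D\<in>F. C \<inter> D \<noteq> {}))"

definition hitting :: "int set set \<Rightarrow> bool" where
  "hitting F \<longleftrightarrow> (\<forall>C\<in>F. \<forall>D\<in>F. C \<noteq> D \<longrightarrow> (\<exists>x\<in>C. - x \<in> D))"

definition unsat_hitting :: "int set set \<Rightarrow> bool" where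
  "unsat_hitting F \<longleftrightarrow> clause_set F \<and> hitting F \<and> \<not> satisfiable F"

definition ldeg :: "int set set \<Rightarrow> int \<Rightarrow> nat" where
  "ldeg F x = card {C \<in> F. x \<in> C}"

definition singular :: "int set set \<Rightarrow> int \<Rightarrow> bool" where
  "singular F v \<longleftrightarrow> v > 0 \<and> min (ldeg F v) (ldeg F (- v)) = 1"

definition nsv :: "int set set \<Rightarrow> nat" where
  "nsv F = card {v. singular F v}"

definition DP :: "int \<Rightarrow> int set set \<Rightarrow> int set set" where
  "DP v F = {(A \<union> B) - {v, - v} | A B. A \<in> F \<and> B \<in> F \<and> A \<inter> uminus ` B = {v}}
            \<union> {A \<in> F. v \<notin> A \<and> - v \<notin> A}"

definition sDP_step :: "int set set \<Rightarrow> int set set \<Rightarrow> bool" where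
  "sDP_step F G \<longleftrightarrow> (\<exists>v. singular F v \<and> G = DP v F)"

text \<open>
  The relation power \<open>(sDP_step ^^ n) F G\<close> says that \<open>G\<close> is the end of a sequence of \<open>n\<close> singular
  DP-reductions starting at \<open>F\<close>; the sequence is maximal iff \<open>G\<close> has no singular variable.
  The description operator denotes the common length of all these maximal sequences, so
  \<open>singind F\<close> is meaningful only where that length is unique, as it is for unsatisfiable
  hitting clause-sets.
\<close>

definition singind :: "int set set \<Rightarrow> nat" where
  "singind F = (THE n. \<exists>G. (sDP_step ^^ n) F G \<and> (\<forall>v. \<not> singular G v))"

end

theory Submission
  imports Defs
begin

text \<open>
  Let \<open>x\<close> be a literal of degree one in an unsatisfiable hitting clause-set \<open>F\<close>, and let \<open>C\<close> be
  the clause containing it. Every clause containing \<open>-x\<close> includes \<open>C - {x}\<close>; hence the singular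
  DP-reduction is just the substitution of true for \<open>x\<close>, any two such reductions commute, and all
  maximal reduction sequences have the same length.

  A reduction lowers only the degrees of the literals of \<open>C - {x}\<close>, each by one, and these degrees
  were at least \<open>1 + ldeg F (-x)\<close>. So a literal of degree one can arise only if \<open>-x\<close> has degree one
  too, and then at most one arises. Therefore every step strictly decreases the number of literals
  of degree one, which is at most \<open>2 * nsv F\<close>.
\<close>

section \<open>Partial assignments and literals of degree one\<close>

text \<open>Takes a literal instead of a variable, so that variables singular through their negative
  literal are covered too.\<close>

definition assign_true :: "int \<Rightarrow> int set set \<Rightarrow> int set set" where
  "assign_true x F = (\<lambda>A. A - {-x}) ` {A \<in> F. x \<notin> A}"

text \<open>Literals are counted because the number of singular variables can stay the same in a
  reduction: a variable whose two literals have degree one may give way to a new singular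
  variable.\<close>

definition unit_lits :: "int set set \<Rightarrow> int set" where
  "unit_lits F = {x. ldeg F x = 1}"

lemma unsat_hittingD:
  assumes "unsat_hitting F"
  shows "finite F" "A \<in> F \<Longrightarrow> finite A" "A \<in> F \<Longrightarrow> 0 \<notin> A" "A \<in> F \<Longrightarrow> x \<in> A \<Longrightarrow> -x \<notin> A"
    "A \<in> F \<Longrightarrow> B \<in> F \<Longrightarrow> A \<noteq> B \<Longrightarrow> \<exists>z\<in>A. -z \<in> B"
    "clause K \<Longrightarrow> \<exists>D\<in>F. K \<inter> D = {}"
proof -
  have F: "finite F" "\<forall>A\<in>F. clause A" "hitting F" "\<not> satisfiable F"
    using assms by (auto simp: unsat_hitting_def clause_set_def)
  show "finite F"
    by (fact F(1))
  show "A \<in> F \<Longrightarrow> finite A" "A \<in> F \<Longrightarrow> 0 \<notin> A" "A \<in> F \<Longrightarrow> x \<in> A \<Longrightarrow> -x \<notin> A"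
    using F(2) by (simp_all add: clause_def)
  show "A \<in> F \<Longrightarrow> B \<in> F \<Longrightarrow> A \<noteq> B \<Longrightarrow> \<exists>z\<in>A. -z \<in> B"
    using F(3) by (simp add: hitting_def)
  show "clause K \<Longrightarrow> \<exists>D\<in>F. K \<inter> D = {}"
    using F(4) by (auto simp: satisfiable_def)
qed

lemma ldeg_pos_iff:
  assumes "finite F"
  shows "0 < ldeg F x \<longleftrightarrow> (\<exists>A\<in>F. x \<in> A)"
  using assms unfolding ldeg_def card_gt_0_iff by auto

lemma ldeg_eq_1_iff: "ldeg F x = 1 \<longleftrightarrow> (\<exists>C. {A \<in> F. x \<in> A} = {C})"
  unfolding ldeg_def by (simp add: card_1_singleton_iff)

lemma unit_litsE:
  assumes "x \<in> unit_lits F"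
  obtains C where "{A \<in> F. x \<in> A} = {C}"
proof -
  have "ldeg F x = 1"
    using assms by (simp add: unit_lits_def)
  then show thesis
    using that unfolding ldeg_eq_1_iff by (elim exE)
qed

section \<open>Structure around a literal of degree one\<close>

text \<open>If \<open>-y\<close> occurred nowhere, setting \<open>y\<close> to true and falsifying
  the rest of \<open>A\<close> would satisfy \<open>F\<close>: every other clause clashes with
  \<open>A\<close>, and not in \<open>y\<close>.\<close>

lemma complement_occurs:
  assumes F: "unsat_hitting F" and A: "A \<in> F" "y \<in> A"
  shows "\<exists>B\<in>F. -y \<in> B"
proof (rule ccontr)
  assume pure: "\<not> ?thesis"
  define K where "K = insert y (uminus ` (A - {y}))"
  note FD = unsat_hittingD[OF F]
  have "clause K"
    using FD(2,3)[OF A(1)] FD(4)[OF A(1)] A(2)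
    unfolding clause_def K_def by (force simp: image_iff)
  then obtain D where D: "D \<in> F" "K \<inter> D = {}"
    using FD(6) by blast
  then have "D \<noteq> A"
    using A(2) by (auto simp: K_def)
  then obtain z where z: "z \<in> D" "-z \<in> A"
    using FD(5)[OF D(1) A(1)] by blast
  have "-z \<noteq> y"
    using pure D(1) z(1) by force
  then have "z \<in> K"
    using z(2) unfolding K_def by force
  then show False
    using z(1) D(2) by blast
qed

text \<open>
  If \<open>y\<close> were missing from \<open>D\<close>, then falsifying \<open>D - {-x}\<close> and setting \<open>-x\<close> and \<open>y\<close> to true would
  satisfy \<open>F\<close>: every other clause clashes with \<open>D\<close>, and not in \<open>x\<close>.
\<close>
lemma main_clause_subset_side_clause:
  assumes F: "unsat_hitting F" and C: "{A \<in> F. x \<in> A} = {C}" and D: "D \<in> F" "-x \<in> D"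
  shows "C - {x} \<subseteq> D"
proof (rule ccontr)
  assume "\<not> ?thesis"
  then obtain y where y: "y \<in> C" "y \<noteq> x" "y \<notin> D"
    by blast
  define K where "K = insert y (insert (-x) (uminus ` (D - {-x})))"
  have CF: "C \<in> F" "x \<in> C"
    using C by blast+
  note FD = unsat_hittingD[OF F]
  \<comment> \<open>Complementary pairs involving \<open>y\<close> are excluded by
    \<open>y \<noteq> x\<close> and \<open>y \<notin> D\<close>.\<close>
  have "clause K"
    using FD(2,3)[OF D(1)] FD(4)[OF D(1)] FD(3)[OF CF(1)] FD(4)[OF CF(1)] CF(2) D(2) y
    unfolding clause_def K_def by (force simp: image_iff)
  then obtain E where E: "E \<in> F" "K \<inter> E = {}"
    using FD(6) by blast
  then have "E \<noteq> D" "E \<noteq> C"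
    using y(1) D(2) by (auto simp: K_def)
  then obtain z where z: "z \<in> E" "-z \<in> D"
    using FD(5)[OF E(1) D(1)] by blast
  have "z \<noteq> x"
    using C E(1) z(1) \<open>E \<noteq> C\<close> by blast
  then have "z \<in> K"
    using z(2) unfolding K_def by force
  then show False
    using z(1) E(2) by blast
qed

text \<open>The literal \<open>y\<close> lies in all clauses containing \<open>-x\<close> and also
  in \<open>C\<close>, which is not one of them.\<close>

lemma ldeg_main_clause_ge:
  assumes F: "unsat_hitting F" and C: "{A \<in> F. x \<in> A} = {C}" and y: "y \<in> C" "y \<noteq> x"
  shows "1 + ldeg F (-x) \<le> ldeg F y"
proof -
  have CF: "C \<in> F" "x \<in> C"
    using C by blast+
  have fin: "finite F" and nC: "-x \<notin> C"
    using unsat_hittingD[OF F] CF by blast+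
  have "insert C {A \<in> F. -x \<in> A} \<subseteq> {A \<in> F. y \<in> A}"
    using main_clause_subset_side_clause[OF F C] y CF by blast
  then have "card (insert C {A \<in> F. -x \<in> A}) \<le> ldeg F y"
    unfolding ldeg_def using fin by (intro card_mono) auto
  then show ?thesis
    using fin nC by (simp add: ldeg_def)
qed

section \<open>Effect of an assignment on the clause-set and its degrees\<close>

text \<open>Distinct clauses avoiding \<open>x\<close> cannot clash in the variable of
  \<open>x\<close>, so their clash survives the deletion of \<open>-x\<close> and no two clauses
  merge. This makes the degree counts exact.\<close>

lemma inj_on_assign_true:
  assumes F: "unsat_hitting F"
  shows "inj_on (\<lambda>A. A - {-x}) {A \<in> F. x \<notin> A}"
proof (rule inj_onI, rule ccontr)
  fix A B
  assume A: "A \<in> {A \<in> F. x \<notin> A}" and B: "B \<in> {A \<in> F. x \<notin> A}"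
    and eq: "A - {-x} = B - {-x}" and "A \<noteq> B"
  then obtain z where z: "z \<in> A" "-z \<in> B"
    using unsat_hittingD(5)[OF F, of A B] by blast
  have "z \<noteq> -x"
    using z B by force
  then have "z \<in> B"
    using z eq by blast
  then show False
    using unsat_hittingD(4)[OF F, of B z] B z by blast
qed

lemma unsat_hitting_assign_true:
  assumes F: "unsat_hitting F" and x: "x \<noteq> 0"
  shows "unsat_hitting (assign_true x F)"
  unfolding unsat_hitting_def
proof (intro conjI notI)
  note FD = unsat_hittingD[OF F]
  show "clause_set (assign_true x F)"
    using FD(1-4) unfolding clause_set_def clause_def assign_true_def by auto
  show "hitting (assign_true x F)"
    unfolding hitting_def
  proof (intro ballI impI)
    fix A' B' assume "A' \<in> assign_true x F" "B' \<in> assign_true x F" "A' \<noteq> B'"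
    then obtain A B where AB: "A \<in> F" "x \<notin> A" "A' = A - {-x}" "B \<in> F" "x \<notin> B" "B' = B - {-x}"
      "A \<noteq> B"
      unfolding assign_true_def by blast
    then obtain z where "z \<in> A" "-z \<in> B"
      using FD(5) by blast
    moreover have "z \<noteq> -x" "-z \<noteq> -x"
      using AB calculation by auto
    ultimately show "\<exists>z\<in>A'. -z \<in> B'"
      using AB by blast
  qed
  assume "satisfiable (assign_true x F)"
  then obtain K where K: "clause K" "\<And>D. D \<in> assign_true x F \<Longrightarrow> K \<inter> D \<noteq> {}"
    unfolding satisfiable_def by blast
  \<comment> \<open>A satisfying \<open>K\<close> is extended by \<open>x\<close>; a clause of
    \<open>F\<close> missed by the extension avoids \<open>x\<close>, so its shortened form is
    missed by \<open>K\<close>.\<close>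
  have "clause (insert x (K - {-x}))"
    using K(1) x unfolding clause_def by auto
  then obtain D where D: "D \<in> F" "insert x (K - {-x}) \<inter> D = {}"
    using FD(6) by blast
  then have "D - {-x} \<in> assign_true x F"
    unfolding assign_true_def by blast
  then show False
    using K(2) D(2) by blast
qed

text \<open>Only \<open>C\<close> is removed, and the other clauses lose at most \<open>-x\<close>
  without merging.\<close>

lemma ldeg_assign_true:
  assumes F: "unsat_hitting F" and C: "{A \<in> F. x \<in> A} = {C}" and y: "y \<noteq> x" "y \<noteq> -x"
  shows "ldeg (assign_true x F) y = (if y \<in> C then ldeg F y - 1 else ldeg F y)"
proof -
  have eq: "{A \<in> assign_true x F. y \<in> A} = (\<lambda>A. A - {-x}) ` {A \<in> F. x \<notin> A \<and> y \<in> A}"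
    unfolding assign_true_def using y by auto
  have "inj_on (\<lambda>A. A - {-x}) {A \<in> F. x \<notin> A \<and> y \<in> A}"
    by (rule inj_on_subset[OF inj_on_assign_true[OF F]]) auto
  then have "ldeg (assign_true x F) y = card {A \<in> F. x \<notin> A \<and> y \<in> A}"
    unfolding ldeg_def eq by (rule card_image)
  also have "{A \<in> F. x \<notin> A \<and> y \<in> A} = {A \<in> F. y \<in> A} - {C}"
    using C by blast
  finally show ?thesis
    using C unsat_hittingD(1)[OF F] by (auto simp: ldeg_def card_Diff_singleton_if)
qed

lemma ldeg_assign_true_self:
  "ldeg (assign_true x F) x = 0" "ldeg (assign_true x F) (-x) = 0"
proof -
  have "{A \<in> assign_true x F. x \<in> A} = {}" "{A \<in> assign_true x F. -x \<in> A} = {}"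
    unfolding assign_true_def by auto
  then show "ldeg (assign_true x F) x = 0" "ldeg (assign_true x F) (-x) = 0"
    unfolding ldeg_def by (simp_all only: card.empty)
qed

lemma unit_lit_nonzero:
  assumes "unsat_hitting F" "x \<in> unit_lits F"
  shows "x \<noteq> 0"
proof -
  obtain C where "{A \<in> F. x \<in> A} = {C}"
    using unit_litsE[OF assms(2)] .
  then have "C \<in> F" "x \<in> C"
    by blast+
  then show ?thesis
    using unsat_hittingD(3)[OF assms(1)] by metis
qed

section \<open>Singular DP-reduction as an assignment\<close>

text \<open>Since \<open>C - {x} \<subseteq> D\<close> for every \<open>D\<close> containing
  \<open>-x\<close>, the resolvent of \<open>C\<close> and \<open>D\<close> is
  \<open>D - {-x}\<close>.\<close>

lemma DP_eq_assign_true: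
  assumes F: "unsat_hitting F" and x: "x \<in> unit_lits F"
  shows "DP \<bar>x\<bar> F = assign_true x F"
proof -
  obtain C where C: "{A \<in> F. x \<in> A} = {C}"
    using unit_litsE[OF x] .
  have CF: "C \<in> F" "x \<in> C"
    using C by blast+
  note FD = unsat_hittingD[OF F]
  have sub: "C - {x} \<subseteq> D" if "D \<in> F" "-x \<in> D" for D
    using main_clause_subset_side_clause[OF F C that] .
  have res: "(C \<union> D) - {x, -x} = D - {-x}" "x \<notin> D" if D: "D \<in> F" "-x \<in> D" for D
  proof -
    show xD: "x \<notin> D"
      using FD(4)[OF D] by simp
    show "(C \<union> D) - {x, -x} = D - {-x}"
      using sub[OF D] xD by blast
  qed
  \<comment> \<open>No \<open>D\<close> containing \<open>-x\<close> clashes with \<open>C\<close>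
    elsewhere, so every such pair is resolvable.\<close>
  have clash: "C \<inter> uminus ` D = {x}" "D \<inter> uminus ` C = {-x}" if D: "D \<in> F" "-x \<in> D" for D
  proof -
    have *: "z = x" if "z \<in> C" "-z \<in> D" for z
      using sub[OF D] FD(4)[OF D(1), of z] that by blast
    have x_mem: "x \<in> uminus ` D" "-x \<in> uminus ` C"
      using D(2) CF(2) by force+
    have "C \<inter> uminus ` D \<subseteq> {x}" "D \<inter> uminus ` C \<subseteq> {-x}"
      using * by auto
    then show "C \<inter> uminus ` D = {x}" "D \<inter> uminus ` C = {-x}"
      using x_mem CF(2) D(2) by blast+
  qed
  have onlyC: "A = C" if "A \<in> F" "x \<in> A" for A
    using C that by blast
  have split: "assign_true x F = {D - {-x} |D. D \<in> F \<and> -x \<in> D} \<union> {A \<in> F. x \<notin> A \<and> -x \<notin> A}"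
  proof (intro equalityI subsetI)
    fix G assume "G \<in> assign_true x F"
    then obtain A where A: "A \<in> F" "x \<notin> A" "G = A - {-x}"
      unfolding assign_true_def by blast
    show "G \<in> {D - {-x} |D. D \<in> F \<and> -x \<in> D} \<union> {A \<in> F. x \<notin> A \<and> -x \<notin> A}"
      using A by (cases "-x \<in> A") auto
  next
    fix G assume "G \<in> {D - {-x} |D. D \<in> F \<and> -x \<in> D} \<union> {A \<in> F. x \<notin> A \<and> -x \<notin> A}"
    then consider D where "D \<in> F" "-x \<in> D" "G = D - {-x}" | "G \<in> F" "x \<notin> G" "G = G - {-x}"
      by blast
    then show "G \<in> assign_true x F"
      unfolding assign_true_def using res(2) by cases blast+
  qed
  show ?thesis
  \<comment> \<open>\<open>DP\<close> resolves on the positive variable: \<open>C\<close> is the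
    first parent if \<open>x\<close> is positive, otherwise the second.\<close>
  proof (cases "x > 0")
    case True
    have "{(A \<union> B) - {x, -x} |A B. A \<in> F \<and> B \<in> F \<and> A \<inter> uminus ` B = {x}}
        = {D - {-x} |D. D \<in> F \<and> -x \<in> D}" (is "?L = ?R")
    proof (intro equalityI subsetI)
      fix G assume "G \<in> ?L"
      then obtain A B where AB: "G = (A \<union> B) - {x, -x}" "A \<in> F" "B \<in> F" "A \<inter> uminus ` B = {x}"
        by blast
      then have "x \<in> A" "x \<in> uminus ` B"
        by blast+
      then have "A = C" "-x \<in> B"
        using onlyC[OF AB(2)] by auto
      then have "G = B - {-x}"
        using AB(1) res(1)[OF AB(3)] by simp
      then show "G \<in> ?R"
        using AB(3) \<open>-x \<in> B\<close> by blast
    next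
      fix G assume "G \<in> ?R"
      then obtain D where D: "D \<in> F" "-x \<in> D" "G = D - {-x}"
        by blast
      then have "G = (C \<union> D) - {x, -x}"
        using res(1) by simp
      then show "G \<in> ?L"
        using clash(1)[OF D(1,2)] CF(1) D(1) by blast
    qed
    then show ?thesis
      using True unfolding DP_def split by simp
  next
    case False
    have "{(A \<union> B) - {-x, x} |A B. A \<in> F \<and> B \<in> F \<and> A \<inter> uminus ` B = {-x}}
        = {D - {-x} |D. D \<in> F \<and> -x \<in> D}" (is "?L = ?R")
    proof (intro equalityI subsetI)
      fix G assume "G \<in> ?L"
      then obtain A B where AB: "G = (A \<union> B) - {-x, x}" "A \<in> F" "B \<in> F" "A \<inter> uminus ` B = {-x}"
        by blast
      then have "-x \<in> A" "-x \<in> uminus ` B"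
        by blast+
      then have "B = C" "-x \<in> A"
        using onlyC[OF AB(3)] by auto
      then have "G = A - {-x}"
        using AB(1) res(1)[OF AB(2)] by (simp add: Un_commute insert_commute)
      then show "G \<in> ?R"
        using AB(2) \<open>-x \<in> A\<close> by blast
    next
      fix G assume "G \<in> ?R"
      then obtain D where D: "D \<in> F" "-x \<in> D" "G = D - {-x}"
        by blast
      then have "G = (D \<union> C) - {-x, x}"
        using res(1)[OF D(1,2)] by blast
      then show "G \<in> ?L"
        using clash(2)[OF D(1,2)] CF(1) D(1) by blast
    qed
    then show ?thesis
      using False unfolding DP_def split by (simp add: conj_commute)
  qed
qed

lemma ldeg_complement_pos:
  assumes F: "unsat_hitting F" and x: "0 < ldeg F x"
  shows "0 < ldeg F (-x)"
  using complement_occurs[OF F] x ldeg_pos_iff[OF unsat_hittingD(1)[OF F]] by blast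

text \<open>A literal of degree one suffices because its complement occurs, so the minimum cannot be
  zero.\<close>

lemma singular_iff:
  assumes F: "unsat_hitting F"
  shows "singular F v \<longleftrightarrow> (\<exists>x\<in>unit_lits F. v = \<bar>x\<bar>)"
proof
  assume "singular F v"
  then have "v > 0" "v \<in> unit_lits F \<or> -v \<in> unit_lits F"
    unfolding singular_def unit_lits_def by (auto simp: min_def split: if_splits)
  then show "\<exists>x\<in>unit_lits F. v = \<bar>x\<bar>"
    by force
next
  assume "\<exists>x\<in>unit_lits F. v = \<bar>x\<bar>"
  then obtain x where x: "x \<in> unit_lits F" "v = \<bar>x\<bar>"
    by blast
  have deg: "ldeg F x = 1" "ldeg F (-x) > 0"
    using x(1) ldeg_complement_pos[OF F, of x] by (auto simp: unit_lits_def)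
  have "v > 0"
    using unit_lit_nonzero[OF F x(1)] x(2) by simp
  then show "singular F v"
    using deg x(2) unfolding singular_def by (cases "x > 0") (auto simp: min_def)
qed

lemma sDP_step_iff:
  assumes F: "unsat_hitting F"
  shows "sDP_step F G \<longleftrightarrow> (\<exists>x\<in>unit_lits F. G = assign_true x F)"
  unfolding sDP_step_def singular_iff[OF F] using DP_eq_assign_true[OF F] by metis

lemma unsat_hitting_sDP_step:
  assumes "unsat_hitting F" "sDP_step F G"
  shows "unsat_hitting G"
  using assms sDP_step_iff unsat_hitting_assign_true unit_lit_nonzero by metis

section \<open>Strict decrease of the number of literals of degree one\<close>

lemma finite_unit_lits:
  assumes F: "unsat_hitting F"
  shows "finite (unit_lits F)"
proof (rule finite_subset)
  show "unit_lits F \<subseteq> \<Union>F"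
  proof
    fix x assume "x \<in> unit_lits F"
    then obtain C where "{A \<in> F. x \<in> A} = {C}"
      by (rule unit_litsE)
    then show "x \<in> \<Union>F"
      by blast
  qed
  show "finite (\<Union>F)"
    using unsat_hittingD(1,2)[OF F] by blast
qed

text \<open>Otherwise \<open>z\<close> would lie in \<open>A\<close> and in a clause containing
  \<open>-y\<close>, hence have degree at least two.\<close>

lemma main_clause_unit_lit_unique:
  assumes F: "unsat_hitting F" and A: "A \<in> F"
    and y: "y \<in> A" "y \<in> unit_lits F" and z: "z \<in> A" "z \<in> unit_lits F"
  shows "y = z"
proof (rule ccontr)
  assume neq: "y \<noteq> z"
  obtain C where C: "{B \<in> F. y \<in> B} = {C}"
    using unit_litsE[OF y(2)] .
  moreover have "A \<in> {B \<in> F. y \<in> B}"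
    using A y(1) by simp
  ultimately have "A = C"
    by simp
  have "1 + ldeg F (-y) \<le> ldeg F z"
    using ldeg_main_clause_ge[OF F C, of z] z(1) neq \<open>A = C\<close> by simp
  moreover have "0 < ldeg F (-y)"
    using ldeg_complement_pos[OF F] y(2) by (simp add: unit_lits_def)
  ultimately show False
    using z(2) by (simp add: unit_lits_def)
qed

lemma card_unit_lits_assign_true_less:
  assumes F: "unsat_hitting F" and x: "x \<in> unit_lits F"
  shows "card (unit_lits (assign_true x F)) < card (unit_lits F)"
proof -
  define G where "G = assign_true x F"
  obtain C where C: "{A \<in> F. x \<in> A} = {C}"
    using unit_litsE[OF x] .
  have G: "unsat_hitting G"
    unfolding G_def using unsat_hitting_assign_true[OF F unit_lit_nonzero[OF F x]] .
  have self: "x \<notin> unit_lits G" "-x \<notin> unit_lits G"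
    unfolding G_def by (simp_all add: unit_lits_def ldeg_assign_true_self)
  define N where "N = unit_lits G - unit_lits F"
  have N: "y \<in> C \<and> y \<noteq> x \<and> ldeg F (-x) = 1" if "y \<in> N" for y
  proof -
    have y: "y \<noteq> x" "y \<noteq> -x" "ldeg G y = 1" "ldeg F y \<noteq> 1"
      using that self by (auto simp: N_def unit_lits_def)
    \<comment> \<open>A new literal of degree one had degree two before, which forces
      \<open>ldeg F (-x)\<close> to be one.\<close>
    then have yC: "y \<in> C" "ldeg F y = 2"
      using ldeg_assign_true[OF F C y(1,2)] by (auto simp: G_def split: if_splits)
    moreover have "1 + ldeg F (-x) \<le> ldeg F y"
      using ldeg_main_clause_ge[OF F C yC(1) y(1)] .
    moreover have "0 < ldeg F (-x)"
      using ldeg_complement_pos[OF F] x by (simp add: unit_lits_def)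
    ultimately show ?thesis
      using y(1) by simp
  qed
  have finG: "finite (unit_lits G)" and finF: "finite (unit_lits F)"
    using finite_unit_lits F G by blast+
  show ?thesis
  proof (cases "N = {}")
    case True
    then have "unit_lits G \<subset> unit_lits F"
      using x self(1) unfolding N_def by blast
    then show ?thesis
      unfolding G_def[symmetric] by (rule psubset_card_mono[OF finF])
  next
    case False
    then obtain y where y: "y \<in> N"
      by blast
    have mx: "-x \<in> unit_lits F"
      using N[OF y] by (simp add: unit_lits_def)
    then obtain D where "{A \<in> F. -x \<in> A} = {D}"
      by (rule unit_litsE)
    then have D: "D \<in> F" "-x \<in> D"
      by blast+
    have "x \<notin> D"
      using unsat_hittingD(4)[OF F D] by simp
    then have DG: "D - {-x} \<in> G"
      unfolding G_def assign_true_def using D(1) by blast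
    \<comment> \<open>All new literals lie in the single clause \<open>D\<close> containing
      \<open>-x\<close>. It survives as \<open>D - {-x}\<close>, which has room for only one literal
      of degree one.\<close>
    have in_D: "z \<in> D - {-x}" if "z \<in> N" for z
      using main_clause_subset_side_clause[OF F C D] N[OF that] self(2) that
      by (auto simp: N_def)
    have "N = {y}"
      using main_clause_unit_lit_unique[OF G DG] in_D y unfolding N_def by blast
    then have "unit_lits G \<subseteq> insert y (unit_lits F - {x, -x})"
      using self unfolding N_def by blast
    then have "card (unit_lits G) \<le> card (insert y (unit_lits F - {x, -x}))"
      using finF by (intro card_mono) auto
    also have "\<dots> \<le> Suc (card (unit_lits F - {x, -x}))"
      by (rule card_insert_le_m1) simp_all
    also have "card (unit_lits F - {x, -x}) = card (unit_lits F) - 2"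
      using x mx unit_lit_nonzero[OF F x] by (subst card_Diff_subset) auto
    \<comment> \<open>Two literals are lost and at most one is gained; this bound keeps the natural
      subtraction of 2 from truncating.\<close>
    also have "card {x, -x} \<le> card (unit_lits F)"
      using x mx finF by (intro card_mono) auto
    then have "Suc (card (unit_lits F) - 2) < card (unit_lits F)"
      using unit_lit_nonzero[OF F x] by simp
    finally show ?thesis
      unfolding G_def .
  qed
qed

section \<open>Commutation and uniqueness of the length\<close>

text \<open>The clause of \<open>x\<close> has no second literal of degree one, so the degree of
  \<open>y\<close> is unaffected.\<close>

lemma unit_lits_assign_true_other:
  assumes F: "unsat_hitting F" and x: "x \<in> unit_lits F" and y: "y \<in> unit_lits F" "\<bar>x\<bar> \<noteq> \<bar>y\<bar>"
  shows "y \<in> unit_lits (assign_true x F)"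
proof -
  obtain C where C: "{A \<in> F. x \<in> A} = {C}"
    using unit_litsE[OF x] .
  then have "C \<in> F" "x \<in> C"
    by blast+
  then have "y \<notin> C"
    using main_clause_unit_lit_unique[OF F _ _ x _ y(1)] y(2) by metis
  then show ?thesis
    using ldeg_assign_true[OF F C, of y] y by (auto simp: unit_lits_def)
qed

lemma assign_true_commute:
  assumes "\<bar>x\<bar> \<noteq> \<bar>y\<bar>"
  shows "assign_true x (assign_true y F) = assign_true y (assign_true x F)"
proof -
  have "assign_true x (assign_true y F) = (\<lambda>A. A - {-x, -y}) ` {A \<in> F. x \<notin> A \<and> y \<notin> A}"
    if "\<bar>x\<bar> \<noteq> \<bar>y\<bar>" for x y
  proof -
    have "{A \<in> assign_true y F. x \<notin> A} = (\<lambda>A. A - {-y}) ` {A \<in> F. x \<notin> A \<and> y \<notin> A}"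
    proof -
      \<comment> \<open>Deleting \<open>-y\<close> thus leaves the occurrences of \<open>x\<close>
        unchanged.\<close>
      have "x \<noteq> -y"
        using that by auto
      then show ?thesis
        unfolding assign_true_def by blast
    qed
    moreover have "A - {-y} - {-x} = A - {-x, -y}" for A
      by blast
    ultimately show ?thesis
      unfolding assign_true_def[of x] by (simp only: image_image)
  qed
  from this[of x y] this[of y x] show ?thesis
    using assms by (simp add: insert_commute conj_commute)
qed

lemma sDP_step_diamond:
  assumes F: "unsat_hitting F" and G: "sDP_step F G" and H: "sDP_step F H" and "G \<noteq> H"
  shows "\<exists>K. sDP_step G K \<and> sDP_step H K"
proof -
  obtain x where x: "x \<in> unit_lits F" "G = assign_true x F"
    using G unfolding sDP_step_iff[OF F] by (elim bexE)
  obtain y where y: "y \<in> unit_lits F" "H = assign_true y F"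
    using H unfolding sDP_step_iff[OF F] by (elim bexE)
  \<comment> \<open>The \<open>DP\<close> form depends only on the variable, so different results
    come from different variables, even if \<open>x\<close> and \<open>-x\<close> both have degree
    one.\<close>
  have "G = DP \<bar>x\<bar> F" "H = DP \<bar>y\<bar> F"
    using DP_eq_assign_true[OF F] x y by simp_all
  then have neq: "\<bar>x\<bar> \<noteq> \<bar>y\<bar>"
    using \<open>G \<noteq> H\<close> by auto
  have "y \<in> unit_lits G" "x \<in> unit_lits H"
    using unit_lits_assign_true_other[OF F] x y neq by simp_all
  then have "sDP_step G (assign_true y G)" "sDP_step H (assign_true x H)"
    using sDP_step_iff[OF unsat_hitting_sDP_step[OF F G]]
      sDP_step_iff[OF unsat_hitting_sDP_step[OF F H]] by auto
  moreover have "assign_true y G = assign_true x H"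
    using assign_true_commute[OF neq] x(2) y(2) by simp
  ultimately show ?thesis
    by auto
qed

text \<open>The diamond closes with exactly one step on each side, so any first step can be
  exchanged into a given maximal sequence without changing its end or length.\<close>

lemma maximal_sequence_from_successor:
  assumes "unsat_hitting F" "(sDP_step ^^ n) F N" "\<forall>v. \<not> singular N v" "sDP_step F H"
  shows "\<exists>m. n = Suc m \<and> (sDP_step ^^ m) H N"
  using assms
proof (induction n arbitrary: F H)
  case 0
  then show ?case
    by (auto simp: sDP_step_def)
next
  case (Suc n)
  then obtain G where G: "sDP_step F G" "(sDP_step ^^ n) G N"
    by (meson relpowp_Suc_E2)
  show ?case
  proof (cases "G = H")
    case True
    then show ?thesis
      using G by blast
  next
    case False
    then obtain K where K: "sDP_step G K" "sDP_step H K"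
      using sDP_step_diamond[OF Suc.prems(1) G(1) Suc.prems(4)] by blast
    obtain m where "n = Suc m" "(sDP_step ^^ m) K N"
      using Suc.IH[OF unsat_hitting_sDP_step[OF Suc.prems(1) G(1)] G(2) Suc.prems(3) K(1)] by blast
    then show ?thesis
      using relpowp_Suc_I2[of sDP_step, OF K(2)] by blast
  qed
qed

lemma maximal_sequence_length_unique:
  assumes "unsat_hitting F" "(sDP_step ^^ n) F N" "\<forall>v. \<not> singular N v"
    "(sDP_step ^^ m) F M" "\<forall>v. \<not> singular M v"
  shows "n = m"
  using assms
proof (induction n arbitrary: F m)
  case 0
  then show ?case
  proof (cases m)
    case (Suc k)
    then obtain G where "sDP_step F G"
      using "0.prems"(4) by (meson relpowp_Suc_E2)
    then show ?thesis
      using "0.prems"(2,3) by (auto simp: sDP_step_def)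
  qed simp
next
  case (Suc n)
  then obtain G where G: "sDP_step F G" "(sDP_step ^^ n) G N"
    by (meson relpowp_Suc_E2)
  obtain k where k: "m = Suc k" "(sDP_step ^^ k) G M"
    using maximal_sequence_from_successor[OF Suc.prems(1,4,5) G(1)] by blast
  then show ?case
    using Suc.IH[OF unsat_hitting_sDP_step[OF Suc.prems(1) G(1)] G(2) Suc.prems(3)] Suc.prems(5)
    by simp
qed

section \<open>Bounding the singularity index\<close>

text \<open>The strict decrease gives termination and the length bound at once.\<close>

lemma maximal_sequence_exists:
  assumes "unsat_hitting F"
  shows "\<exists>n N. (sDP_step ^^ n) F N \<and> (\<forall>v. \<not> singular N v) \<and> n \<le> card (unit_lits F)"
  using assms
proof (induction "card (unit_lits F)" arbitrary: F rule: less_induct)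
  case less
  show ?case
  proof (cases "\<exists>v. singular F v")
    case False
    then have "(sDP_step ^^ 0) F F \<and> (\<forall>v. \<not> singular F v) \<and> 0 \<le> card (unit_lits F)"
      by simp
    then show ?thesis
      by blast
  next
    case True
    then obtain x where x: "x \<in> unit_lits F"
      using singular_iff[OF less.prems] by blast
    define G where "G = assign_true x F"
    have step: "sDP_step F G"
      using sDP_step_iff[OF less.prems] x by (auto simp: G_def)
    have less_G: "card (unit_lits G) < card (unit_lits F)"
      unfolding G_def by (rule card_unit_lits_assign_true_less[OF less.prems x])
    obtain n N where n: "(sDP_step ^^ n) G N" "\<forall>v. \<not> singular N v" "n \<le> card (unit_lits G)"
      using less.hyps[OF less_G unsat_hitting_sDP_step[OF less.prems step]] by blast
    have "(sDP_step ^^ Suc n) F N"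
      using relpowp_Suc_I2[of sDP_step, OF step n(1)] .
    then show ?thesis
      using n less_G by (meson Suc_leI le_less_trans)
  qed
qed

lemma singind_le_card_unit_lits:
  assumes F: "unsat_hitting F"
  shows "singind F \<le> card (unit_lits F)"
proof -
  obtain n N where n: "(sDP_step ^^ n) F N" "\<forall>v. \<not> singular N v" "n \<le> card (unit_lits F)"
    using maximal_sequence_exists[OF F] by blast
  \<comment> \<open>Uniqueness of the length makes the description operator well defined.\<close>
  have "singind F = n"
    unfolding singind_def
    by (rule the_equality) (use n maximal_sequence_length_unique[OF F _ _ n(1,2)] in blast)+
  then show ?thesis
    using n(3) by simp
qed

text \<open>Each singular variable has at most two literals of degree one, whence the factor
  2.\<close>

lemma card_unit_lits_le_nsv:
  assumes F: "unsat_hitting F"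
  shows "card (unit_lits F) \<le> 2 * nsv F"
proof -
  define S where "S = {v. singular F v}"
  have S: "S = abs ` unit_lits F"
    unfolding S_def singular_iff[OF F] by blast
  then have fin: "finite S"
    using finite_unit_lits[OF F] by simp
  have "unit_lits F \<subseteq> S \<union> uminus ` S"
  proof
    fix x assume "x \<in> unit_lits F"
    then have "\<bar>x\<bar> \<in> S"
      unfolding S by simp
    moreover have "x = \<bar>x\<bar> \<or> x = - \<bar>x\<bar>"
      by arith
    ultimately show "x \<in> S \<union> uminus ` S"
      by (metis UnI1 UnI2 imageI)
  qed
  then have "card (unit_lits F) \<le> card (S \<union> uminus ` S)"
    using fin by (intro card_mono) auto
  also have "\<dots> \<le> card S + card (uminus ` S)"
    by (rule card_Un_le)
  also have "\<dots> \<le> 2 * card S"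
    using card_image_le[OF fin, of uminus] by simp
  finally show ?thesis
    by (simp add: nsv_def S_def)
qed

theorem lemma7:
  fixes F :: "int set set"
  assumes "unsat_hitting F"
  shows "real (nsv F) \<ge> 1 / 2 * real (singind F)"
  using singind_le_card_unit_lits[OF assms] card_unit_lits_le_nsv[OF assms] by linarith

end
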